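(* Let $B$ be a finite set of forbidden permutation patterns, and suppose that the class of permutations avoiding every pattern in $B$ has a regular insertion encoding. Then that class also has a finite flexible scheme.
   Context: A permutation of length $n$ is a reordering $\sigma=\sigma_1\cdots\sigma_n$ of $\{1,\dots,n\}$; $\emptyset$ is the empty permutation. The reduction of a string of distinct numbers is the permutation of the same length whose entries are in the same relative order. $\sigma$ contains a pattern $p$ (a permutation of length $k$) if some $\sigma_{i_1}\cdots\sigma_{i_k}$ with $i_1<\dots<i_k$ reduces to $p$; otherwise $\sigma$ avoids $p$. Insertion encoding. A nonempty permutation is built by inserting its entries in the order $1,2,3,\dots$, starting from the configuration consisting of a single slot $\diamond$. A new entry $x$ may only be inserted in a slot, and every slot must eventually contain at least one entry. Slots are numbered $1,2,\dots$ from left to right. Inserting $x$ in slot $j$ is one of four moves: $m_j$ replaces the slot by $\diamond x\diamond$; $l_j$ replaces it by $x\diamond$; $r_j$ replaces it by $\diamond x$; $f_j$ replaces it by $x$. The process ends when no slots remain. Each nonempty permutation arises from a unique sequence of moves, which is its encoding word (for example $24513$ is encoded by $m_1l_1f_2l_1f_1$). A class of permutations has a regular insertion encoding if the set of encoding words of its nonempty members is a regular language (over some finite subset of the alphabet $\{m_j,l_j,r_j,f_j: j\ge1\}$). Downfixes and gap vectors. For $0\le l\le n$, the downfix of length $l$ of $\sigma$ is the subsequence $\sigma_{i_1}\cdots\sigma_{i_l}$ ($i_1<\dots<i_l$) of the entries with values in $\{1,\dots,l\}$, in the order in which they occur in $\sigma$. The corresponding gap vector is $[i_1-1,\,i_2-i_1-1,\,\dots,\,i_l-i_{l-1}-1,\,n-i_l]$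 (it is $[n]$ if $l=0$). For vectors $\mathbf g,\mathbf h$ of nonnegative integers of the same length, $\mathbf g\succeq\mathbf h$ means $g_i\ge h_i$ for all $i$. For a permutation $\pi$ and $\mathbf g\in\mathbb N^{|\pi|+1}$ ($\mathbb N=\{0,1,2,\dots\}$), $Z(B,\pi,\mathbf g)$ is the set of permutations of length $|\pi|+\sum_i g_i$ avoiding every pattern in $B$ whose downfix of length $|\pi|$ is $\pi$ with corresponding gap vector $\mathbf g$. Deletion: for $1\le i\le k$, $d_i(\pi_1\cdots\pi_k)$ is the reduction of $\pi_1\cdots\pi_{i-1}\pi_{i+1}\cdots\pi_k$, and $d_i([g_1,\dots,g_{k+1}])=[g_1,\dots,g_{i-1},g_i+g_{i+1},g_{i+2},\dots,g_{k+1}]$. The refinements of $\pi$ are the $|\pi|+1$ permutations obtained by inserting the entry $|\pi|+1$ somewhere in $\pi$. Flexible schemes. A replacement rule is a pair $[\pi,\mathbf H]$, where $\pi$ is a permutation (downfix) and $\mathbf H$ is either the empty list $[\,]$ (meaning no reduction of $\pi$ is given) or a list $\big[[\mathbf{h_1},r_1],\dots,[\mathbf{h_k},r_k]\big]$ with $\mathbf{h_i}\in\mathbb N^{|\pi|+1}$, $\mathbf{h_k}=[0,\dots,0]$ and $r_i\in\{0,1,\dots,|\pi|\}$, such that for every $\mathbf g\in\mathbb N^{|\pi|+1}$, if $i$ is minimal with $\mathbf g\succeq\mathbf{h_i}$, then $|Z(B,\pi,\mathbf g)|=0$ if $r_i=0$, and $|Z(B,\pi,\mathbf g)|=|Z(B,d_{r_i}(\pi),d_{r_i}(\mathbf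 g))|$ if $r_i\ne0$. A downfix $\pi$ is called FS-reducible if it has a rule with nonempty $\mathbf H$. The class of permutations avoiding $B$ has a finite flexible scheme if there is a finite set $S$ of replacement rules, at most one for each $\pi$, such that: $S$ contains a rule for $\emptyset$; whenever $[\pi,[\,]]\in S$, $S$ contains a rule for every refinement of $\pi$; and whenever $[\pi,\mathbf H]\in S$ with $\mathbf H$ nonempty, $S$ contains a rule for $d_{r_i}(\pi)$ for every $r_i\neq0$ occurring in $\mathbf H$. *)

theory Defs
  imports "HOL-Library.Sublist" "HOL-Combinatorics.Multiset_Permutations"
begin

text \<open>A permutation of length \<open>n\<close> is the list of its values \<open>\<sigma>\<^sub>1, \<dots>, \<sigma>\<^sub>n\<close> in \<open>{1..n}\<close>.
  All indices that occur in the mathematics (moves, deletions, positions) are 1-based;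
  Isabelle's list positions are 0-based.\<close>

definition is_perm :: "nat list \<Rightarrow> bool" where
  "is_perm \<sigma> \<longleftrightarrow> \<sigma> \<in> permutations_of_set {1..length \<sigma>}"

definition reduction :: "nat list \<Rightarrow> nat list" where
  "reduction xs = map (\<lambda>x. card {y \<in> set xs. y \<le> x}) xs"

definition contains_pattern :: "nat list \<Rightarrow> nat list \<Rightarrow> bool" where
  "contains_pattern \<sigma> p \<longleftrightarrow> (\<exists>s. subseq s \<sigma> \<and> reduction s = p)"

definition Av :: "nat list set \<Rightarrow> nat list set" where
  "Av B = {\<sigma>. is_perm \<sigma> \<and> (\<forall>p\<in>B. \<not> contains_pattern \<sigma> p)}"


subsection \<open>Insertion encoding\<close>

text \<open>Regular means accepted by a deterministic finite automaton over a finite alphabet \<open>\<Sigma>\<close>.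
  Taking the states to be natural numbers is no restriction.\<close>

definition regular_language :: "'a list set \<Rightarrow> bool" where
  "regular_language L \<longleftrightarrow>
     (\<exists>(\<Sigma> :: 'a set) (Q :: nat set) q0 \<delta> F.
        finite \<Sigma> \<and> finite Q \<and> q0 \<in> Q \<and> F \<subseteq> Q \<and>
        (\<forall>q\<in>Q. \<forall>a\<in>\<Sigma>. \<delta> q a \<in> Q) \<and>
        L = {w \<in> lists \<Sigma>. foldl \<delta> q0 w \<in> F})"

datatype move = M nat | L nat | R nat | F nat

text \<open>In a configuration, \<^term>\<open>None\<close> is a slot and \<^term>\<open>Some x\<close> is the entry \<open>x\<close>.\<close>

type_synonym config = "nat option list"

inductive insertion_step :: "nat \<Rightarrow> config \<Rightarrow> move \<Rightarrow> config \<Rightarrow> bool" where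
  middle: "count_list u None + 1 = j \<Longrightarrow>
    insertion_step x (u @ [None] @ v) (M j) (u @ [None, Some x, None] @ v)"
| left: "count_list u None + 1 = j \<Longrightarrow>
    insertion_step x (u @ [None] @ v) (L j) (u @ [Some x, None] @ v)"
| right: "count_list u None + 1 = j \<Longrightarrow>
    insertion_step x (u @ [None] @ v) (R j) (u @ [None, Some x] @ v)"
| fill: "count_list u None + 1 = j \<Longrightarrow>
    insertion_step x (u @ [None] @ v) (F j) (u @ [Some x] @ v)"

text \<open>\<open>insertion_steps x c w c'\<close>: the moves \<open>w\<close>, inserting the entries
  \<open>x, x + 1, \<dots>\<close> in this order, lead from \<open>c\<close> to \<open>c'\<close>.\<close>

inductive insertion_steps :: "nat \<Rightarrow> config \<Rightarrow> move list \<Rightarrow> config \<Rightarrow> bool" where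
  Nil: "insertion_steps x c [] c"
| Cons: "insertion_step x c a c' \<Longrightarrow> insertion_steps (x + 1) c' w c'' \<Longrightarrow>
    insertion_steps x c (a # w) c''"

text \<open>That every slot receives an entry is expressed by the absence of slots
  in the final configuration.\<close>

definition insertion_encodes :: "move list \<Rightarrow> nat list \<Rightarrow> bool" where
  "insertion_encodes w \<sigma> \<longleftrightarrow> insertion_steps 1 [None] w (map Some \<sigma>)"

definition has_regular_insertion_encoding :: "nat list set \<Rightarrow> bool" where
  "has_regular_insertion_encoding C \<longleftrightarrow>
     regular_language {w. \<exists>\<sigma>\<in>C. \<sigma> \<noteq> [] \<and> insertion_encodes w \<sigma>}"


subsection \<open>Downfixes and gap vectors\<close>

definition downfix :: "nat \<Rightarrow> nat list \<Rightarrow> nat list" where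
  "downfix l \<sigma> = filter (\<lambda>x. x \<le> l) \<sigma>"

definition downfix_positions :: "nat \<Rightarrow> nat list \<Rightarrow> nat list" where
  "downfix_positions l \<sigma> = filter (\<lambda>i. \<sigma> ! (i - 1) \<le> l) [1..<length \<sigma> + 1]"

text \<open>With the conventions \<open>i\<^sub>0 = 0\<close> and \<open>i\<^bsub>l+1\<^esub> = n + 1\<close>, all components of the gap vector,
  including the first and the last one, have the form \<open>i\<^bsub>k+1\<^esub> - i\<^sub>k - 1\<close>.\<close>

definition gap_vector :: "nat \<Rightarrow> nat list \<Rightarrow> nat list" where
  "gap_vector l \<sigma> = map2 (\<lambda>i i'. i' - i - 1)
     (0 # downfix_positions l \<sigma>) (downfix_positions l \<sigma> @ [length \<sigma> + 1])"

definition dominates :: "nat list \<Rightarrow> nat list \<Rightarrow> bool" where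
  "dominates g h \<longleftrightarrow> list_all2 (\<ge>) g h"

definition Z :: "nat list set \<Rightarrow> nat list \<Rightarrow> nat list \<Rightarrow> nat list set" where
  "Z B \<pi> g = {\<sigma> \<in> Av B. length \<sigma> = length \<pi> + sum_list g \<and>
     downfix (length \<pi>) \<sigma> = \<pi> \<and> gap_vector (length \<pi>) \<sigma> = g}"

definition delete_perm :: "nat \<Rightarrow> nat list \<Rightarrow> nat list" where
  "delete_perm i \<pi> = reduction (take (i - 1) \<pi> @ drop i \<pi>)"

definition delete_gap :: "nat \<Rightarrow> nat list \<Rightarrow> nat list" where
  "delete_gap i g = take (i - 1) g @ [g ! (i - 1) + g ! i] @ drop (i + 1) g"

definition refinements :: "nat list \<Rightarrow> nat list set" where
  "refinements \<pi> = {take i \<pi> @ [length \<pi> + 1] @ drop i \<pi> | i. i \<le> length \<pi>}"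


subsection \<open>Flexible schemes\<close>

type_synonym rule = "nat list \<times> (nat list \<times> nat) list"

definition first_dominated :: "nat list \<Rightarrow> (nat list \<times> nat) list \<Rightarrow> nat \<Rightarrow> bool" where
  "first_dominated g H i \<longleftrightarrow> i < length H \<and> dominates g (fst (H ! i)) \<and>
     (\<forall>j<i. \<not> dominates g (fst (H ! j)))"

definition replacement_rule :: "nat list set \<Rightarrow> rule \<Rightarrow> bool" where
  "replacement_rule B = (\<lambda>(\<pi>, H). is_perm \<pi> \<and>
     (H = [] \<or>
       (\<forall>(h, r) \<in> set H. length h = length \<pi> + 1 \<and> r \<le> length \<pi>) \<and>
       fst (last H) = replicate (length \<pi> + 1) 0 \<and>
       (\<forall>g i. length g = length \<pi> + 1 \<and> first_dominated g H i \<longrightarrow>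
          (let r = snd (H ! i) in
             (r = 0 \<longrightarrow> card (Z B \<pi> g) = 0) \<and>
             (r \<noteq> 0 \<longrightarrow> card (Z B \<pi> g) = card (Z B (delete_perm r \<pi>) (delete_gap r g)))))))"

definition flexible_scheme :: "nat list set \<Rightarrow> rule set \<Rightarrow> bool" where
  "flexible_scheme B S \<longleftrightarrow>
     (\<forall>\<rho>\<in>S. replacement_rule B \<rho>) \<and>
     (\<forall>\<pi> H H'. (\<pi>, H) \<in> S \<and> (\<pi>, H') \<in> S \<longrightarrow> H = H') \<and>
     [] \<in> fst ` S \<and>
     (\<forall>\<pi>. (\<pi>, []) \<in> S \<longrightarrow> refinements \<pi> \<subseteq> fst ` S) \<and>
     (\<forall>\<pi> H h r. (\<pi>, H) \<in> S \<and> (h, r) \<in> set H \<and> r \<noteq> 0 \<longrightarrow> delete_perm r \<pi> \<in> fst ` S)"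

definition has_finite_flexible_scheme :: "nat list set \<Rightarrow> bool" where
  "has_finite_flexible_scheme B \<longleftrightarrow> (\<exists>S. finite S \<and> flexible_scheme B S)"

end

theory Submission
  imports Defs
begin

text \<open>A configuration reached on the way to a member of the class has a number of slots that depends only
  on the automaton state, so regularity bounds the number of nonzero gaps by some \<open>K\<close>: for any
  other gap vector \<open>Z\<close> is empty. Whether a filling of the slots of a downfix \<open>\<pi>\<close> creates
  a forbidden pattern, all of length at most \<open>m\<close>, depends only on which order-isomorphism types
  of at most \<open>m\<close> entries of \<open>\<pi>\<close>, together with the positions of the slots between them, occur.
  There are boundedly many such types. Choosing one occurrence of each, some entry of a sufficiently long
  \<open>\<pi>\<close> is in none of the chosen occurrences; any forbidden occurrence can be rerouted around
  that entry, so deleting it changes no count. The entry depends only on the support of the gap vector,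
  hence one rule with a vector \<open>h\<close> for each support suffices for each \<open>\<pi>\<close>, and all
  permutations up to a fixed length form a scheme.\<close>

subsection \<open>Configurations with their slots filled\<close>

definition lows :: "config \<Rightarrow> nat set" where
  "lows c = {x. Some x \<in> set c}"

text \<open>The analogue of \<open>reduction\<close> for configurations: entries are standardised,
  slots keep their places. These are the order types counted in the pigeonhole argument.\<close>

definition shape :: "config \<Rightarrow> config" where
  "shape c = map (map_option (\<lambda>x. card {y \<in> lows c. y \<le> x})) c"

text \<open>Words go into the slots from left to right. The third equation is a default for missing
  words; wherever \<open>expand\<close> describes a permutation, there is one word per slot.\<close>

fun expand :: "config \<Rightarrow> nat list list \<Rightarrow> nat list" where
  "expand [] ws = []"
| "expand (Some x # c) ws = x # expand c ws"
| "expand (None # c) [] = expand c []"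
| "expand (None # c) (w # ws) = w @ expand c ws"

lemma lows_simps [simp]:
  "lows [] = {}" "lows (Some x # c) = insert x (lows c)" "lows (None # c) = lows c"
  "lows (c @ d) = lows c \<union> lows d"
  by (auto simp: lows_def)

lemma finite_lows [simp]: "finite (lows c)"
proof (induction c)
  case (Cons a c)
  then show ?case by (cases a) auto
qed simp

lemma card_lows: "card (lows c) + count_list c None \<le> length c"
proof (induction c)
  case (Cons a c)
  then show ?case by (cases a) (auto simp: card_insert_if)
qed simp

lemma set_expand: "length ws = count_list c None \<Longrightarrow> set (expand c ws) = lows c \<union> set (concat ws)"
  by (induction c ws rule: expand.induct) auto

lemma expand_map:
  assumes "\<forall>x\<in>set (concat ws). f x = x"
  shows "expand (map (map_option f) c) ws = map f (expand c ws)"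
  using assms by (induction c ws rule: expand.induct) (auto intro: map_idI[symmetric])

text \<open>A subsequence splits into the part \<open>d\<close> taken from \<open>c\<close> and the
  parts \<open>vs\<close> taken from the words. Slots whose word contributes nothing stay in
  \<open>d\<close>, so that words and slots remain aligned; hence the slot count in the length
  bound.\<close>

lemma subseq_expandD:
  assumes "subseq s (expand c ws)" "length ws = count_list c None"
  shows "\<exists>d vs. subseq d c \<and> count_list d None = count_list c None \<and> length vs = length ws \<and>
    list_all2 subseq vs ws \<and> s = expand d vs \<and> length d \<le> length s + count_list c None"
  using assms
proof (induction c ws arbitrary: s rule: expand.induct)
  case (1 ws)
  then show ?case by auto
next
  case (2 x c ws)
  show ?case
  proof (cases "subseq s (expand c ws)")
    case True
    with 2 obtain d vs where "subseq d c" "count_list d None = count_list c None"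
      "length vs = length ws" "list_all2 subseq vs ws" "s = expand d vs"
      "length d \<le> length s + count_list c None" by fastforce
    then show ?thesis by (intro exI[of _ d] exI[of _ vs]) auto
  next
    case False
    with 2(2) obtain s' where s: "s = x # s'" "subseq s' (expand c ws)"
      by (cases s) (auto split: if_splits)
    with 2 obtain d vs where "subseq d c" "count_list d None = count_list c None"
      "length vs = length ws" "list_all2 subseq vs ws" "s' = expand d vs"
      "length d \<le> length s' + count_list c None" by fastforce
    then show ?thesis using s by (intro exI[of _ "Some x # d"] exI[of _ vs]) auto
  qed
next
  case (3 c)
  then show ?case by simp
next
  case (4 c w ws)
  from 4(2) obtain v s' where s: "s = v @ s'" "subseq v w" "subseq s' (expand c ws)"
    by (auto elim: subseq_appendE)
  with 4 obtain d vs where "subseq d c" "count_list d None = count_list c None"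
    "length vs = length ws" "list_all2 subseq vs ws" "s' = expand d vs"
    "length d \<le> length s' + count_list c None" by fastforce
  then show ?case using s by (intro exI[of _ "None # d"] exI[of _ "v # vs"]) auto
qed

lemma subseq_set_subset: "subseq xs ys \<Longrightarrow> set xs \<subseteq> set ys"
  by (induction rule: list_emb.induct) auto

lemma count_list_subseq: "subseq d c \<Longrightarrow> count_list d x \<le> count_list c x"
  by (induction rule: list_emb.induct) auto

text \<open>The way back from \<open>subseq_expandD\<close>: the same parts \<open>vs\<close> can be
  put into any other subconfiguration that keeps all slots.\<close>

lemma subseq_expandI:
  assumes "subseq d c" "count_list d None = count_list c None"
    "length ws = count_list c None" "list_all2 subseq vs ws"
  shows "subseq (expand d vs) (expand c ws)"
  using assms
proof (induction arbitrary: vs ws rule: list_emb.induct)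
  case (list_emb_Nil c)
  then show ?case by simp
next
  case (list_emb_Cons d c y)
  then show ?case
  proof (cases y)
    case None
    \<comment> \<open>Skipping the slot \<open>y\<close> would leave \<open>d\<close> with fewer
      slots than \<open>y # c\<close>, so this case is contradictory.\<close>
    then show ?thesis using list_emb_Cons.hyps list_emb_Cons.prems count_list_subseq[of d c None] by simp
  next
    case (Some a)
    then show ?thesis using list_emb_Cons by (auto intro: list_emb.list_emb_Cons)
  qed
next
  case (list_emb_Cons2 x y d c)
  then have xy: "x = y" by simp
  show ?case
  proof (cases y)
    case None
    with list_emb_Cons2.prems obtain w ws' v vs' where ws: "ws = w # ws'" "vs = v # vs'"
      by (cases ws; cases vs) auto
    with list_emb_Cons2 xy None have "subseq v w" "subseq (expand d vs') (expand c ws')" by auto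
    then show ?thesis using xy None ws by (simp add: list_emb_append_mono)
  next
    case (Some a)
    then show ?thesis using list_emb_Cons2 xy by auto
  qed
qed

section \<open>Order types of filled configurations\<close>

lemma reduction_map:
  assumes "strict_mono_on (set s) f"
  shows "reduction (map f s) = reduction s"
  unfolding reduction_def map_map
proof (rule map_cong[OF refl])
  fix x assume x: "x \<in> set s"
  have iff: "f y \<le> f x \<longleftrightarrow> y \<le> x" if "y \<in> set s" for y
    using strict_mono_on_less_eq[OF assms that x] .
  have "{y \<in> set (map f s). y \<le> f x} = f ` {y \<in> set s. y \<le> x}"
    using iff by (simp add: set_eq_iff image_iff) blast
  moreover have "inj_on f {y \<in> set s. y \<le> x}"
    by (rule inj_on_subset[OF strict_mono_on_imp_inj_on[OF assms]]) simp
  ultimately show "((\<lambda>x. card {y \<in> set (map f s). y \<le> x}) \<circ> f) x = card {y \<in> set s. y \<le> x}"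
    by (simp add: card_image)
qed

text \<open>Passing to the shape is an order-preserving relabelling \<open>f\<close> of all entries:
  the ranks of low entries stay at most \<open>l\<close>, and the entries of the words, all above
  \<open>l\<close>, are fixed.\<close>

lemma reduction_expand_shape:
  assumes "lows c \<subseteq> {1..l}" "set (concat ws) \<subseteq> {l<..}" "length ws = count_list c None"
  shows "reduction (expand (shape c) ws) = reduction (expand c ws)"
proof -
  define f where "f x = (if x \<le> l then card {y \<in> lows c. y \<le> x} else x)" for x
  have le: "card {y \<in> lows c. y \<le> x} \<le> l" for x
    using card_mono[of "{1..l}" "{y \<in> lows c. y \<le> x}"] assms(1) by auto
  have less: "card {z \<in> lows c. z \<le> x} < card {z \<in> lows c. z \<le> y}" if "x < y" "y \<in> lows c" for x y
  proof (rule psubset_card_mono)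
    have "y \<in> {z \<in> lows c. z \<le> y}" "y \<notin> {z \<in> lows c. z \<le> x}" using that by simp_all
    then have "{z \<in> lows c. z \<le> x} \<noteq> {z \<in> lows c. z \<le> y}" by metis
    moreover have "{z \<in> lows c. z \<le> x} \<subseteq> {z \<in> lows c. z \<le> y}" using that(1) by auto
    ultimately show "{z \<in> lows c. z \<le> x} \<subset> {z \<in> lows c. z \<le> y}" by (rule psubsetI[rotated])
  qed simp
  have "lows c \<subseteq> {..l}" using assms(1) by auto
  then have "map_option (\<lambda>x. card {y \<in> lows c. y \<le> x}) a = map_option f a" if "a \<in> set c" for a
    using that by (cases a) (auto simp: f_def lows_def)
  then have "shape c = map (map_option f) c"
    unfolding shape_def by (rule map_cong[OF refl])
  moreover have high: "l < x" if "x \<in> set (concat ws)" for x using assms(2) that by blast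
  then have "\<forall>x\<in>set (concat ws). f x = x" unfolding f_def by (metis leD)
  ultimately have "expand (shape c) ws = map f (expand c ws)" by (simp add: expand_map)
  moreover have "strict_mono_on (set (expand c ws)) f"
    unfolding set_expand[OF assms(3)]
  proof (rule strict_mono_onI)
    fix x y assume y: "y \<in> lows c \<union> set (concat ws)" and xy: "x < y"
    show "f x < f y"
    proof (cases "y \<le> l")
      case True
      then have "y \<in> lows c" using y high[of y] by fastforce
      then show ?thesis using less[OF xy] True xy by (simp add: f_def)
    next
      case False
      then show ?thesis using le[of x] xy by (simp add: f_def)
    qed
  qed
  ultimately show ?thesis by (simp add: reduction_map)
qed

section \<open>Pigeonhole: an entry that no order type requires\<close>

definition shapes :: "nat \<Rightarrow> nat \<Rightarrow> config set" where
  "shapes m K = {c. set c \<subseteq> insert None (Some ` {..m}) \<and> length c \<le> m + K}"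

lemma finite_shapes: "finite (shapes m K)"
  unfolding shapes_def by (rule finite_lists_length_le) simp

text \<open>A representative is fixed for each shape of a subconfiguration in \<open>G\<close>, and
  it serves as \<open>d'\<close>. Since it keeps all slots, it has at most \<open>m\<close> entries;
  its shape lies in the finite set \<open>shapes m K\<close>, so the representatives together cannot
  exhaust \<open>X\<close>. Later \<open>X\<close> is the set of entries of the downfix.\<close>

lemma ex_redundant_entry:
  assumes "count_list c None \<le> K" "card (shapes m K) * m < card X" "finite X"
  obtains x where "x \<in> X"
    "\<And>d. subseq d c \<Longrightarrow> count_list d None = count_list c None \<Longrightarrow> length d \<le> m + count_list c None \<Longrightarrow>
      \<exists>d'. subseq d' c \<and> count_list d' None = count_list c None \<and> shape d' = shape d \<and> x \<notin> lows d'"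
proof -
  define G where "G = {d. subseq d c \<and> count_list d None = count_list c None \<and> length d \<le> m + count_list c None}"
  define rep where "rep s = (SOME d. d \<in> G \<and> shape d = s)" for s
  have rep: "rep (shape d) \<in> G" "shape (rep (shape d)) = shape d" if "d \<in> G" for d
    using someI[of "\<lambda>e. e \<in> G \<and> shape e = shape d" d] that unfolding rep_def by auto
  have low: "card (lows d) \<le> m" if "d \<in> G" for d
    using card_lows[of d] that unfolding G_def by simp
  have "shape d \<in> shapes m K" if "d \<in> G" for d
  proof -
    have "card {y \<in> lows d. y \<le> x} \<le> m" for x
      using low[OF that] card_mono[of "lows d" "{y \<in> lows d. y \<le> x}"] by simp
    then have "map_option (\<lambda>x. card {y \<in> lows d. y \<le> x}) a \<in> insert None (Some ` {..m})" for a
      by (cases a) auto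
    then show ?thesis using that assms(1) unfolding shapes_def shape_def G_def by auto
  qed
  then have sub: "shape ` G \<subseteq> shapes m K" by auto
  then have fin: "finite (shape ` G)" using finite_shapes finite_subset by blast
  let ?U = "\<Union>s\<in>shape ` G. lows (rep s)"
  have "card ?U \<le> (\<Sum>s\<in>shape ` G. card (lows (rep s)))" by (rule card_UN_le[OF fin])
  also have "\<dots> \<le> (\<Sum>s\<in>shape ` G. m)" by (rule sum_mono) (auto intro: low rep)
  also have "\<dots> \<le> card (shapes m K) * m" using card_mono[OF finite_shapes sub] by simp
  also have "\<dots> < card X" by fact
  finally have "card ?U < card X" .
  moreover have "finite ?U" by (rule finite_UN_I[OF fin]) simp
  ultimately have "\<not> X \<subseteq> ?U" by (meson card_mono linorder_not_less)
  then obtain x where x: "x \<in> X" "x \<notin> ?U" by blast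
  show ?thesis
  proof (rule that[OF x(1)])
    fix d assume "subseq d c" "count_list d None = count_list c None" "length d \<le> m + count_list c None"
    then have d: "d \<in> G" by (simp add: G_def)
    with rep[OF d] x(2) show "\<exists>d'. subseq d' c \<and> count_list d' None = count_list c None \<and> shape d' = shape d \<and> x \<notin> lows d'"
      by (intro exI[of _ "rep (shape d)"]) (auto simp: G_def)
  qed
qed

section \<open>Avoidance after removal of the redundant entry\<close>

definition avoids :: "nat list set \<Rightarrow> nat list \<Rightarrow> bool" where
  "avoids B \<sigma> \<longleftrightarrow> (\<forall>p\<in>B. \<not> contains_pattern \<sigma> p)"

lemma length_reduction [simp]: "length (reduction s) = length s"
  by (simp add: reduction_def)

lemma subseq_filter_neq: "subseq s t \<Longrightarrow> x \<notin> set s \<Longrightarrow> subseq s (filter (\<lambda>y. y \<noteq> x) t)"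
  by (induction rule: list_emb.induct) auto

text \<open>Removing entries never creates a pattern. Conversely, an occurrence of a pattern in
  \<open>B\<close> has at most \<open>m\<close> entries, so its part \<open>d\<close> in
  \<open>c\<close> can be exchanged for some \<open>d'\<close> of the same shape without
  \<open>x\<close>. The parts in the words are kept; they lie above \<open>l\<close> and so do not
  contain \<open>x\<close>.\<close>

lemma avoids_filter_redundant:
  assumes x: "\<And>d. subseq d c \<Longrightarrow> count_list d None = count_list c None \<Longrightarrow> length d \<le> m + count_list c None \<Longrightarrow>
      \<exists>d'. subseq d' c \<and> count_list d' None = count_list c None \<and> shape d' = shape d \<and> x \<notin> lows d'"
    and B: "\<forall>p\<in>B. length p \<le> m"
    and "lows c \<subseteq> {1..l}" "set (concat ws) \<subseteq> {l<..}" "length ws = count_list c None" "x \<le> l"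
  shows "avoids B (filter (\<lambda>y. y \<noteq> x) (expand c ws)) \<longleftrightarrow> avoids B (expand c ws)"
proof -
  have "contains_pattern (filter (\<lambda>y. y \<noteq> x) (expand c ws)) p" if "p \<in> B" "contains_pattern (expand c ws) p" for p
  proof -
    from that(2) obtain s where s: "subseq s (expand c ws)" "reduction s = p"
      unfolding contains_pattern_def by auto
    then have len: "length s \<le> m" using B that(1) by auto
    from subseq_expandD[OF s(1) assms(5)] obtain d vs where d: "subseq d c" "count_list d None = count_list c None"
      "length vs = length ws" "list_all2 subseq vs ws" "s = expand d vs"
      "length d \<le> length s + count_list c None" by blast
    with len have "length d \<le> m + count_list c None" by simp
    from x[OF d(1,2) this] obtain d' where d': "subseq d' c" "count_list d' None = count_list c None"
      "shape d' = shape d" "x \<notin> lows d'" by blast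
    have sub: "lows e \<subseteq> {1..l}" if "subseq e c" for e
      using subseq_set_subset[OF that] assms(3) unfolding lows_def by auto
    have vs: "set (concat vs) \<subseteq> {l<..}"
    proof -
      have "set (concat vs) \<subseteq> set (concat ws)"
        using d(4) by (induction rule: list_all2_induct) (auto dest: subseq_set_subset)
      then show ?thesis using assms(4) by auto
    qed
    have "reduction (expand d' vs) = reduction (expand d vs)"
      using reduction_expand_shape[OF sub vs, of d'] reduction_expand_shape[OF sub vs, of d] d d' assms(5) by simp
    moreover have "subseq (expand d' vs) (expand c ws)"
      using subseq_expandI d' d(4) assms(5) by blast
    moreover have "x \<notin> set (expand d' vs)"
      using set_expand[of vs d'] d d' assms(5,6) vs by auto
    ultimately have "subseq (expand d' vs) (filter (\<lambda>y. y \<noteq> x) (expand c ws))"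
      "reduction (expand d' vs) = p" using s(2) d(5) subseq_filter_neq by auto
    then show ?thesis unfolding contains_pattern_def by blast
  qed
  moreover have "contains_pattern (expand c ws) p" if "contains_pattern (filter P (expand c ws)) p" for P p
    using that subseq_filter_left subseq_order.trans unfolding contains_pattern_def by blast
  ultimately show ?thesis unfolding avoids_def by blast
qed

subsection \<open>Gap vectors and interleavings\<close>

text \<open>A gap of any positive size becomes a single slot, so \<open>skeleton\<close> remembers
  only the support of the gap vector.\<close>

definition slots :: "nat \<Rightarrow> config" where
  "slots a = (if a = 0 then [] else [None])"

primrec skeleton :: "nat list \<Rightarrow> nat list \<Rightarrow> config" where
  "skeleton [] g = slots (hd g)"
| "skeleton (p # \<pi>) g = slots (hd g) @ Some p # skeleton \<pi> (tl g)"

text \<open>Rebuilds a permutation from its downfix, its gap vector and the word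
  \<open>\<tau>\<close> of its remaining entries. The last gap takes whatever is left of
  \<open>\<tau>\<close>, which is the right amount when
  \<open>sum_list g = length \<tau>\<close>.\<close>

primrec weave :: "nat list \<Rightarrow> nat list \<Rightarrow> nat list \<Rightarrow> nat list" where
  "weave [] g \<tau> = \<tau>"
| "weave (p # \<pi>) g \<tau> = take (hd g) \<tau> @ p # weave \<pi> (tl g) (drop (hd g) \<tau>)"

text \<open>A form of \<open>gap_vector\<close> suited to induction along the permutation: a high
  entry lengthens the gap at the head, a low entry opens a new one.\<close>

primrec gaps :: "(nat \<Rightarrow> bool) \<Rightarrow> nat list \<Rightarrow> nat list" where
  "gaps P [] = [0]"
| "gaps P (x # \<sigma>) = (if P x then 0 # gaps P \<sigma> else Suc (hd (gaps P \<sigma>)) # tl (gaps P \<sigma>))"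

lemma gaps_neq_Nil [simp]: "gaps P \<sigma> \<noteq> []"
  by (cases \<sigma>) auto

lemma downfix_positions_Cons:
  "downfix_positions l (x # \<sigma>) = (if x \<le> l then [1] else []) @ map Suc (downfix_positions l \<sigma>)"
proof -
  have "[1..<length (x # \<sigma>) + 1] = 1 # map Suc [1..<length \<sigma> + 1]"
    by (simp add: map_Suc_upt upt_conv_Cons del: upt_Suc)
  moreover have "filter (\<lambda>i. (x # \<sigma>) ! (i - 1) \<le> l) (map Suc [1..<length \<sigma> + 1]) = map Suc (downfix_positions l \<sigma>)"
    unfolding downfix_positions_def filter_map
    by (intro arg_cong[where f = "map Suc"] filter_cong) (auto simp: nth_Cons')
  ultimately show ?thesis by (simp add: downfix_positions_def del: upt_Suc)
qed

lemma gap_vector_eq_gaps: "gap_vector l \<sigma> = gaps (\<lambda>x. x \<le> l) \<sigma>"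
proof (induction \<sigma>)
  case Nil
  then show ?case by (simp add: gap_vector_def downfix_positions_def)
next
  case (Cons x \<sigma>)
  let ?P = "downfix_positions l \<sigma>" and ?D = "\<lambda>i i'. i' - i - 1 :: nat"
  have shift: "map2 ?D (map Suc xs) (map Suc ys) = map2 ?D xs ys" for xs ys
    by (induction xs ys rule: list_induct2') auto
  have eq: "gap_vector l \<sigma> = map2 ?D (0 # ?P) (?P @ [length \<sigma> + 1])" by (simp add: gap_vector_def)
  show ?case
  proof (cases "x \<le> l")
    case True
    then have "gap_vector l (x # \<sigma>) = 0 # map2 ?D (map Suc (0 # ?P)) (map Suc (?P @ [length \<sigma> + 1]))"
      by (simp add: gap_vector_def downfix_positions_Cons)
    then show ?thesis unfolding shift eq[symmetric] using True Cons.IH by simp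
  next
    case False
    obtain a as where a: "?P @ [length \<sigma> + 1] = a # as" by (cases ?P) auto
    have "a \<in> set (?P @ [length \<sigma> + 1])" using a by simp
    \<comment> \<open>Subtraction is truncated: the new first gap \<open>a\<close> is the successor
      of \<open>a - 0 - 1\<close> only for positive \<open>a\<close>.\<close>
    then have "a \<ge> 1" by (auto simp: downfix_positions_def)
    have "gap_vector l (x # \<sigma>) = map2 ?D (0 # map Suc ?P) (map Suc (?P @ [length \<sigma> + 1]))"
      using False by (simp add: gap_vector_def downfix_positions_Cons)
    also have "\<dots> = a # map2 ?D ?P as" unfolding a using shift[of ?P as] by simp
    also have "\<dots> = Suc (hd (gap_vector l \<sigma>)) # tl (gap_vector l \<sigma>)"
      unfolding eq a using \<open>a \<ge> 1\<close> by simp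
    finally show ?thesis using False Cons.IH by simp
  qed
qed

lemma weave_gaps: "weave (filter P \<sigma>) (gaps P \<sigma>) (filter (\<lambda>x. \<not> P x) \<sigma>) = \<sigma>"
proof (induction \<sigma>)
  case (Cons x \<sigma>)
  then show ?case by (cases "filter P \<sigma>"; cases "gaps P \<sigma>") auto
qed simp

lemma gaps_append_low: "\<forall>x\<in>set v. \<not> P x \<Longrightarrow> P p \<Longrightarrow> gaps P (v @ p # \<sigma>) = length v # gaps P \<sigma>"
  by (induction v) auto

lemma gaps_high: "\<forall>x\<in>set v. \<not> P x \<Longrightarrow> gaps P v = [length v]"
  by (induction v) auto

text \<open>With \<open>weave_gaps\<close>, this shows that weaving and splitting are mutually
  inverse.\<close>

lemma weave_props:
  assumes "length g = length \<pi> + 1" "sum_list g = length \<tau>" "\<forall>x\<in>set \<pi>. P x" "\<forall>x\<in>set \<tau>. \<not> P x"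
  shows "filter P (weave \<pi> g \<tau>) = \<pi>" "filter (\<lambda>x. \<not> P x) (weave \<pi> g \<tau>) = \<tau>" "gaps P (weave \<pi> g \<tau>) = g"
proof -
  have "filter P (weave \<pi> g \<tau>) = \<pi> \<and> filter (\<lambda>x. \<not> P x) (weave \<pi> g \<tau>) = \<tau> \<and> gaps P (weave \<pi> g \<tau>) = g"
    using assms
  proof (induction \<pi> arbitrary: g \<tau>)
    case Nil
    then show ?case by (cases g) (auto simp: gaps_high filter_id_conv)
  next
    case (Cons p \<pi>)
    then obtain a g' where g: "g = a # g'" by (cases g) auto
    have le: "a \<le> length \<tau>" using Cons.prems(2) g by simp
    have "filter P (weave \<pi> g' (drop a \<tau>)) = \<pi> \<and> filter (\<lambda>x. \<not> P x) (weave \<pi> g' (drop a \<tau>)) = drop a \<tau> \<and> gaps P (weave \<pi> g' (drop a \<tau>)) = g'"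
      by (rule Cons.IH) (use Cons.prems g in \<open>auto dest: in_set_dropD\<close>)
    moreover have "\<forall>x\<in>set (take a \<tau>). \<not> P x" using Cons.prems(4) by (auto dest: in_set_takeD)
    ultimately show ?case using Cons.prems(3) g le
      by (simp add: gaps_append_low filter_False filter_True)
  qed
  then show "filter P (weave \<pi> g \<tau>) = \<pi>" "filter (\<lambda>x. \<not> P x) (weave \<pi> g \<tau>) = \<tau>" "gaps P (weave \<pi> g \<tau>) = g"
    by auto
qed

lemma mset_weave:
  "mset (weave \<pi> g \<tau>) = mset \<pi> + mset \<tau>"
proof (induction \<pi> arbitrary: g \<tau>)
  case (Cons p \<pi>)
  have "mset \<tau> = mset (take (hd g) \<tau>) + mset (drop (hd g) \<tau>)"
    by (metis append_take_drop_id mset_append)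
  then show ?case using Cons by simp
qed simp

lemma map_weave: "map f (weave \<pi> g \<tau>) = weave (map f \<pi>) g (map f \<tau>)"
  by (induction \<pi> arbitrary: g \<tau>) (auto simp: take_map drop_map)

section \<open>Skeletons and their fillings\<close>

lemma lows_slots [simp]: "lows (slots a) = {}"
  by (simp add: slots_def)

lemma lows_skeleton: "lows (skeleton \<pi> g) = set \<pi>"
  by (induction \<pi> arbitrary: g) auto

lemma count_list_skeleton:
  "length g = length \<pi> + 1 \<Longrightarrow> count_list (skeleton \<pi> g) None = length (filter (\<lambda>a. a \<noteq> 0) g)"
proof (induction \<pi> arbitrary: g)
  case Nil
  then show ?case by (cases g) (auto simp: slots_def)
next
  case (Cons p \<pi>)
  then show ?case by (cases g) (auto simp: slots_def)
qed

definition support_vector :: "nat list \<Rightarrow> nat list" where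
  "support_vector g = map (\<lambda>a. if a = 0 then 0 else 1) g"

lemma skeleton_support_vector:
  "length g = length \<pi> + 1 \<Longrightarrow> skeleton \<pi> (support_vector g) = skeleton \<pi> g"
proof (induction \<pi> arbitrary: g)
  case Nil
  then show ?case by (cases g) (auto simp: slots_def support_vector_def)
next
  case (Cons p \<pi>)
  then show ?case by (cases g) (auto simp: slots_def support_vector_def)
qed

text \<open>Cutting \<open>\<tau>\<close> at the gap sizes yields the words; a zero gap gives
  neither a slot nor a word. The sizes are thus moved into \<open>ws\<close>, and the configuration
  depends on the support alone.\<close>

lemma weave_eq_expand_skeleton:
  assumes "length g = length \<pi> + 1" "sum_list g = length \<tau>"
  shows "\<exists>ws. length ws = count_list (skeleton \<pi> g) None \<and> concat ws = \<tau> \<and>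
    weave \<pi> g \<tau> = expand (skeleton \<pi> g) ws"
  using assms
proof (induction \<pi> arbitrary: g \<tau>)
  case Nil
  then have "g = [length \<tau>]" by (cases g) auto
  then show ?case
    by (intro exI[of _ "if \<tau> = [] then [] else [\<tau>]"]) (auto simp: slots_def)
next
  case (Cons p \<pi>)
  then obtain a g' where g: "g = a # g'" by (cases g) auto
  have "\<exists>ws. length ws = count_list (skeleton \<pi> g') None \<and> concat ws = drop a \<tau> \<and>
    weave \<pi> g' (drop a \<tau>) = expand (skeleton \<pi> g') ws"
    by (rule Cons.IH) (use Cons.prems g in auto)
  then obtain ws where ws: "length ws = count_list (skeleton \<pi> g') None" "concat ws = drop a \<tau>"
    "weave \<pi> g' (drop a \<tau>) = expand (skeleton \<pi> g') ws" by blast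
  then show ?case unfolding g
    by (intro exI[of _ "if a = 0 then ws else take a \<tau> # ws"]) (auto simp: slots_def)
qed

lemma weave_delete:
  assumes "length g = length \<pi> + 1" "sum_list g = length \<tau>" "0 < r" "r \<le> length \<pi>"
    "distinct \<pi>" "set \<pi> \<inter> set \<tau> = {}"
  shows "weave (take (r - 1) \<pi> @ drop r \<pi>) (delete_gap r g) \<tau> = filter (\<lambda>y. y \<noteq> \<pi> ! (r - 1)) (weave \<pi> g \<tau>)"
  using assms
proof (induction \<pi> arbitrary: g \<tau> r)
  case (Cons p \<pi>)
  then obtain a b g' where g: "g = a # b # g'" by (cases g; cases "tl g") auto
  show ?case
  proof (cases "r = 1")
    case True
    \<comment> \<open>Deleting the first entry merges the gaps \<open>a\<close> and
      \<open>b\<close>. The case split is due to the last gap, which absorbs the rest of the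
      word.\<close>
    have "weave \<pi> ((a + b) # g') \<tau> = take a \<tau> @ weave \<pi> (b # g') (drop a \<tau>)"
      using Cons.prems(2) g by (cases \<pi>) (auto simp: take_add add.commute)
    moreover have "p \<notin> set (weave \<pi> (b # g') (drop a \<tau>))"
    proof -
      have "set (weave \<pi> (b # g') (drop a \<tau>)) = set \<pi> \<union> set (drop a \<tau>)"
        by (metis mset_weave set_mset_mset set_mset_union)
      then show ?thesis using Cons.prems(5,6) by (auto dest: in_set_dropD)
    qed
    moreover have "p \<notin> set (take a \<tau>)" using Cons.prems(6) by (auto dest: in_set_takeD)
    moreover have "filter (\<lambda>y. y \<noteq> p) xs = xs" if "p \<notin> set xs" for xs
      using that by (auto simp: filter_id_conv)
    ultimately show ?thesis using True g by (simp add: delete_gap_def)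
  next
    case False
    then obtain r' where r: "r = Suc (Suc r')" using Cons.prems(3) by (metis One_nat_def Suc_pred not0_implies_Suc not_gr_zero)
    have "weave (take (Suc r' - 1) \<pi> @ drop (Suc r') \<pi>) (delete_gap (Suc r') (b # g')) (drop a \<tau>) = filter (\<lambda>y. y \<noteq> \<pi> ! (Suc r' - 1)) (weave \<pi> (b # g') (drop a \<tau>))"
      by (rule Cons.IH) (use Cons.prems g r in \<open>auto dest: in_set_dropD\<close>)
    moreover have "\<pi> ! r' \<in> set \<pi>" using Cons.prems(4) r by simp
    moreover have "p \<noteq> \<pi> ! r'" using calculation(2) Cons.prems(5) by auto
    moreover have "filter (\<lambda>y. y \<noteq> \<pi> ! r') (take a \<tau>) = take a \<tau>"
      using calculation(2) Cons.prems(6) by (auto simp: filter_id_conv dest: in_set_takeD)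
    ultimately show ?thesis using g r by (simp add: delete_gap_def)
  qed
qed simp

subsection \<open>Deleting an entry of the downfix\<close>

lemma avoids_map:
  assumes "strict_mono_on (set \<sigma>) f"
  shows "avoids B (map f \<sigma>) \<longleftrightarrow> avoids B \<sigma>"
proof -
  have red: "reduction (map f s) = reduction s" if "subseq s \<sigma>" for s
    by (rule reduction_map, rule strict_mono_onI, rule strict_mono_onD[OF assms])
      (use subseq_set_subset[OF that] in auto)
  have "contains_pattern (map f \<sigma>) p \<longleftrightarrow> contains_pattern \<sigma> p" for p
  proof
    assume "contains_pattern (map f \<sigma>) p"
    then obtain s where s: "subseq s (map f \<sigma>)" "reduction s = p" by (auto simp: contains_pattern_def)
    then obtain A where "s = map f (nths \<sigma> A)" by (auto simp: subseq_conv_nths nths_map)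
    moreover have "subseq (nths \<sigma> A) \<sigma>" by (auto simp: subseq_conv_nths)
    ultimately show "contains_pattern \<sigma> p" using red s(2) by (auto simp: contains_pattern_def)
  next
    assume "contains_pattern \<sigma> p"
    then obtain s where "subseq s \<sigma>" "reduction s = p" by (auto simp: contains_pattern_def)
    with red show "contains_pattern (map f \<sigma>) p"
      by (auto simp: contains_pattern_def intro!: exI[of _ "map f s"] subseq_map)
  qed
  then show ?thesis by (simp add: avoids_def)
qed

lemma is_perm_iff: "is_perm \<sigma> \<longleftrightarrow> set \<sigma> = {1..length \<sigma>} \<and> distinct \<sigma>"
  by (auto simp: is_perm_def permutations_of_set_def)

text \<open>Downfix and gap vector leave open only the order \<open>\<tau>\<close> of the values
  above \<open>length \<pi>\<close>, so counting \<open>Z\<close> becomes counting such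
  orders.\<close>

lemma Z_eq_weave:
  assumes "is_perm \<pi>" "length g = length \<pi> + 1"
  shows "Z B \<pi> g = weave \<pi> g ` {\<tau> \<in> permutations_of_set {length \<pi> <.. length \<pi> + sum_list g}.
    avoids B (weave \<pi> g \<tau>)}" (is "_ = weave \<pi> g ` ?T")
    and "inj_on (weave \<pi> g) {\<tau> \<in> permutations_of_set {length \<pi> <.. length \<pi> + sum_list g}.
    avoids B (weave \<pi> g \<tau>)}"
proof -
  let ?N = "length \<pi>" and ?P = "\<lambda>x. x \<le> length \<pi>"
  have T: "set \<tau> = {?N <.. ?N + sum_list g}" "distinct \<tau>" "sum_list g = length \<tau>" if "\<tau> \<in> ?T" for \<tau>
    using that distinct_card[of \<tau>] by (auto simp: permutations_of_set_def)
  have low: "\<forall>x\<in>set \<pi>. ?P x" using assms(1) by (simp add: is_perm_iff)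
  have props: "filter ?P (weave \<pi> g \<tau>) = \<pi>" "filter (\<lambda>x. \<not> ?P x) (weave \<pi> g \<tau>) = \<tau>"
    "gaps ?P (weave \<pi> g \<tau>) = g" if "\<tau> \<in> ?T" for \<tau>
    using weave_props[OF assms(2) T(3)[OF that] low] T(1)[OF that] by auto
  show "inj_on (weave \<pi> g) ?T" 
  proof (rule inj_onI)
    fix \<tau> \<tau>' assume "\<tau> \<in> ?T" "\<tau>' \<in> ?T" "weave \<pi> g \<tau> = weave \<pi> g \<tau>'"
    then show "\<tau> = \<tau>'" using props(2)[of \<tau>] props(2)[of \<tau>'] by argo
  qed
  show "Z B \<pi> g = weave \<pi> g ` ?T"
  proof (intro equalityI subsetI)
    fix \<sigma> assume "\<sigma> \<in> Z B \<pi> g"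
    then have \<sigma>: "is_perm \<sigma>" "avoids B \<sigma>" "length \<sigma> = ?N + sum_list g" "filter ?P \<sigma> = \<pi>" "gaps ?P \<sigma> = g"
      by (simp_all add: Z_def Av_def avoids_def downfix_def gap_vector_eq_gaps)
    let ?\<tau> = "filter (\<lambda>x. \<not> ?P x) \<sigma>"
    have eq: "\<sigma> = weave \<pi> g ?\<tau>" using weave_gaps[of ?P \<sigma>] unfolding \<sigma>(4,5) by (rule sym)
    have "set ?\<tau> = {?N <.. ?N + sum_list g}" using \<sigma>(1,3) by (auto simp: is_perm_iff)
    moreover have "distinct ?\<tau>" using \<sigma>(1) by (simp add: is_perm_iff)
    ultimately have "?\<tau> \<in> ?T" using \<sigma>(2) by (simp add: permutations_of_set_def eq[symmetric])
    with eq show "\<sigma> \<in> weave \<pi> g ` ?T" by blast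
  next
    fix \<sigma> assume "\<sigma> \<in> weave \<pi> g ` ?T"
    then obtain \<tau> where \<tau>: "\<tau> \<in> ?T" and \<sigma>: "\<sigma> = weave \<pi> g \<tau>" by blast
    have mset: "mset \<sigma> = mset (\<pi> @ \<tau>)" unfolding \<sigma> mset_weave by simp
    have len: "length \<sigma> = ?N + sum_list g" using mset_eq_length[OF mset] T(3)[OF \<tau>] by simp
    have "set \<sigma> = set \<pi> \<union> set \<tau>" using mset_eq_setD[OF mset] by simp
    then have "set \<sigma> = {1..length \<sigma>}" using T(1)[OF \<tau>] assms(1) len by (auto simp: is_perm_iff)
    moreover have "distinct \<sigma>"
      using mset_eq_imp_distinct_iff[OF mset] T(1,2)[OF \<tau>] assms(1) by (auto simp: is_perm_iff)
    ultimately show "\<sigma> \<in> Z B \<pi> g"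
      using \<tau> props[OF \<tau>] len
      by (simp add: Z_def Av_def avoids_def is_perm_iff downfix_def gap_vector_eq_gaps \<sigma>)
  qed
qed

lemma card_Z:
  assumes "is_perm \<pi>" "length g = length \<pi> + 1"
  shows "card (Z B \<pi> g) = card {\<tau> \<in> permutations_of_set {length \<pi> <.. length \<pi> + sum_list g}.
    avoids B (weave \<pi> g \<tau>)}"
  using Z_eq_weave[OF assms] by (simp add: card_image)

lemma delete_gap_props:
  assumes "0 < r" "r < length g"
  shows "length (delete_gap r g) = length g - 1" "sum_list (delete_gap r g) = sum_list g"
proof -
  have "drop (r - 1) g = g ! (r - 1) # g ! r # drop (r + 1) g"
    using Cons_nth_drop_Suc[of "r - 1" g] Cons_nth_drop_Suc[of r g] assms by simp
  then have g: "take (r - 1) g @ g ! (r - 1) # g ! r # drop (r + 1) g = g"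
    using append_take_drop_id[of "r - 1" g] by simp
  show "length (delete_gap r g) = length g - 1" using assms by (simp add: delete_gap_def)
  show "sum_list (delete_gap r g) = sum_list g"
    using arg_cong[OF g, of sum_list] by (simp add: delete_gap_def)
qed

text \<open>The order isomorphism that closes the hole left by the deleted value
  \<open>x\<close>.\<close>

definition close_up :: "nat \<Rightarrow> nat \<Rightarrow> nat" where
  "close_up x y = (if x < y then y - 1 else y)"

lemma strict_mono_close_up: "x \<notin> A \<Longrightarrow> strict_mono_on A (close_up x)"
proof (rule strict_mono_onI)
  fix y z assume "x \<notin> A" "y \<in> A" "z \<in> A" "y < z"
  moreover from this have "y \<noteq> x" by blast
  ultimately show "close_up x y < close_up x z" by (auto simp: close_up_def)
qed

text \<open>Among the values \<open>1, ..., length \<pi>\<close> without \<open>x\<close>, the rank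
  of \<open>z\<close> is \<open>z\<close> below \<open>x\<close> and \<open>z - 1\<close> above it,
  so the reduction acts as \<open>close_up x\<close>.\<close>

lemma delete_perm_eq:
  assumes "is_perm \<pi>" "0 < r" "r \<le> length \<pi>"
  shows "delete_perm r \<pi> = map (close_up (\<pi> ! (r - 1))) (take (r - 1) \<pi> @ drop r \<pi>)"
    and "is_perm (delete_perm r \<pi>)" "length (delete_perm r \<pi>) = length \<pi> - 1"
proof -
  let ?x = "\<pi> ! (r - 1)" and ?\<pi> = "take (r - 1) \<pi> @ drop r \<pi>" and ?N = "length \<pi>"
  have "drop (r - 1) \<pi> = ?x # drop r \<pi>"
    using Cons_nth_drop_Suc[of "r - 1" \<pi>] assms(2,3) by simp
  then have \<pi>: "take (r - 1) \<pi> @ ?x # drop r \<pi> = \<pi>"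
    using append_take_drop_id[of "r - 1" \<pi>] by simp
  have "distinct (take (r - 1) \<pi> @ ?x # drop r \<pi>)" "set (take (r - 1) \<pi> @ ?x # drop r \<pi>) = {1..?N}"
    using assms(1) unfolding \<pi> by (simp_all add: is_perm_iff)
  then have dist: "distinct ?\<pi>" and "?x \<notin> set ?\<pi>" and ins: "insert ?x (set ?\<pi>) = {1..?N}"
    by simp_all
  then have set: "set ?\<pi> = {1..?N} - {?x}" by (metis Diff_insert_absorb)
  have x: "?x \<in> {1..?N}" unfolding ins[symmetric] by (rule insertI1)
  have card: "card {y \<in> {1..?N} - {?x}. y \<le> z} = close_up ?x z" if "z \<in> {1..?N} - {?x}" for z
  proof -
    have z: "z \<noteq> ?x" "z \<le> ?N" using that by simp_all
    then have "{y \<in> {1..?N} - {?x}. y \<le> z} = {1..z} - {?x}" by auto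
    moreover have "card ({1..z} - {?x}) = close_up ?x z"
      using x z(1) unfolding close_up_def by (simp add: card_Diff_singleton_if)
    ultimately show ?thesis by simp
  qed
  show eq: "delete_perm r \<pi> = map (close_up ?x) ?\<pi>"
    unfolding delete_perm_def reduction_def set
  proof (rule map_cong[OF refl])
    fix z assume "z \<in> set ?\<pi>"
    then show "card {y \<in> {1..?N} - {?x}. y \<le> z} = close_up ?x z" unfolding set by (rule card)
  qed
  show len: "length (delete_perm r \<pi>) = ?N - 1" using assms(2,3) by (simp add: delete_perm_def)
  have inj: "inj_on (close_up ?x) (set ?\<pi>)"
    unfolding set by (rule strict_mono_on_imp_inj_on[OF strict_mono_close_up]) simp
  have "close_up ?x ` ({1..?N} - {?x}) = {1..?N - 1}"
  proof (intro equalityI subsetI)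
    fix y assume "y \<in> {1..?N - 1}"
    then have "close_up ?x (if y < ?x then y else Suc y) = y"
      "(if y < ?x then y else Suc y) \<in> {1..?N} - {?x}" by (auto simp: close_up_def)
    then show "y \<in> close_up ?x ` ({1..?N} - {?x})" by (metis image_eqI)
  qed (use x in \<open>auto simp: close_up_def\<close>)
  then show "is_perm (delete_perm r \<pi>)"
    unfolding is_perm_iff len unfolding eq using dist inj set by (simp only: set_map distinct_map)
qed

text \<open>Both sides count orders of high values, and on these \<open>close_up\<close> subtracts
  1, with inverse \<open>Suc\<close>. The shorter weave is the \<open>close_up\<close> image of the
  longer one with \<open>\<pi> ! (r - 1)\<close> filtered out, so \<open>redundant\<close> matches
  the avoidance conditions.\<close>

lemma card_Z_delete:
  assumes "is_perm \<pi>" "length g = length \<pi> + 1" "0 < r" "r \<le> length \<pi>"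
    and redundant: "\<And>\<tau>. \<tau> \<in> permutations_of_set {length \<pi> <.. length \<pi> + sum_list g} \<Longrightarrow>
      avoids B (filter (\<lambda>y. y \<noteq> \<pi> ! (r - 1)) (weave \<pi> g \<tau>)) \<longleftrightarrow> avoids B (weave \<pi> g \<tau>)"
  shows "card (Z B \<pi> g) = card (Z B (delete_perm r \<pi>) (delete_gap r g))"
proof -
  let ?x = "\<pi> ! (r - 1)" and ?\<pi> = "delete_perm r \<pi>" and ?g = "delete_gap r g" and ?N = "length \<pi>"
    and ?f = "close_up (\<pi> ! (r - 1))"
  let ?T = "permutations_of_set {?N <.. ?N + sum_list g}"
  let ?T' = "permutations_of_set {?N - 1 <.. ?N - 1 + sum_list g}"
  note d = delete_perm_eq[OF assms(1,3,4)]
  have len: "length ?g = length ?\<pi> + 1" "sum_list ?g = sum_list g"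
    using delete_gap_props[of r g] assms(2-4) d(3) by auto
  have "?x \<in> set \<pi>" using assms(3,4) by simp
  then have x: "?x \<le> ?N" "0 < ?x" using assms(1) by (auto simp: is_perm_iff)
  \<comment> \<open>The range of \<open>r\<close> forces \<open>length \<pi>\<close> to be positive,
    so \<open>?N - 1\<close> is not truncated.\<close>
  have shift: "Suc ` {?N - 1 <.. ?N - 1 + sum_list g} = {?N <.. ?N + sum_list g}"
  proof (intro equalityI subsetI)
    fix y assume "y \<in> {?N <.. ?N + sum_list g}"
    then have "y = Suc (y - 1)" "y - 1 \<in> {?N - 1 <.. ?N - 1 + sum_list g}" using assms(3,4) by auto
    then show "y \<in> Suc ` {?N - 1 <.. ?N - 1 + sum_list g}" by (rule image_eqI)
  qed (use assms(3,4) in auto)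
  have high: "?f y = y - 1" if "y > ?N" for y using that x by (simp add: close_up_def)
  have avoid: "avoids B (weave ?\<pi> ?g (map ?f \<tau>)) \<longleftrightarrow> avoids B (weave \<pi> g \<tau>)" if "\<tau> \<in> ?T" for \<tau>
  proof -
    have \<tau>: "sum_list g = length \<tau>" "set \<tau> = {?N <.. ?N + sum_list g}"
      using that distinct_card[of \<tau>] by (auto simp: permutations_of_set_def)
    have "weave ?\<pi> ?g (map ?f \<tau>) = map ?f (filter (\<lambda>y. y \<noteq> ?x) (weave \<pi> g \<tau>))"
      unfolding d(1) map_weave[symmetric]
      by (rule arg_cong[where f = "map ?f"], rule weave_delete)
        (use assms \<tau> in \<open>auto simp: is_perm_iff\<close>)
    moreover have "strict_mono_on (set (filter (\<lambda>y. y \<noteq> ?x) (weave \<pi> g \<tau>))) ?f"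
      by (rule strict_mono_close_up) simp
    ultimately show ?thesis using redundant[OF that] by (simp add: avoids_map)
  qed
  have bij: "map ?f \<tau> \<in> ?T'" "map Suc (map ?f \<tau>) = \<tau>" if "\<tau> \<in> ?T" for \<tau>
  proof -
    have \<tau>: "set \<tau> = {?N <.. ?N + sum_list g}" "distinct \<tau>"
      using that by (auto simp: permutations_of_set_def)
    then have f: "map ?f \<tau> = map (\<lambda>y. y - 1) \<tau>" using high by (intro map_cong) auto
    show "map Suc (map ?f \<tau>) = \<tau>" unfolding f using \<tau> by (auto intro!: map_idI)
    then have "distinct (map Suc (map ?f \<tau>))" using \<tau>(2) by simp
    then have "distinct (map ?f \<tau>)" by (simp only: distinct_map)
    moreover have "Suc ` set (map ?f \<tau>) = Suc ` {?N - 1 <.. ?N - 1 + sum_list g}"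
      unfolding shift set_map[symmetric] \<open>map Suc (map ?f \<tau>) = \<tau>\<close> by (rule \<tau>(1))
    then have "set (map ?f \<tau>) = {?N - 1 <.. ?N - 1 + sum_list g}" by (simp only: inj_image_eq_iff[OF inj_Suc])
    ultimately show "map ?f \<tau> \<in> ?T'" by (simp add: permutations_of_set_def)
  qed
  have bij': "map Suc \<tau> \<in> ?T" "map ?f (map Suc \<tau>) = \<tau>" if "\<tau> \<in> ?T'" for \<tau>
  proof -
    have \<tau>: "set \<tau> = {?N - 1 <.. ?N - 1 + sum_list g}" "distinct \<tau>"
      using that by (auto simp: permutations_of_set_def)
    have "Suc ` set \<tau> = {?N <.. ?N + sum_list g}"
      unfolding \<tau>(1) by (rule shift)
    then show "map Suc \<tau> \<in> ?T" using \<tau>(2) by (simp add: permutations_of_set_def distinct_map)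
    show "map ?f (map Suc \<tau>) = \<tau>"
      unfolding map_map using \<tau>(1) assms(3,4) high by (intro map_idI) auto
  qed
  have "bij_betw (map ?f) {\<tau> \<in> ?T. avoids B (weave \<pi> g \<tau>)} {\<tau> \<in> ?T'. avoids B (weave ?\<pi> ?g \<tau>)}"
  proof (rule bij_betw_byWitness[where f' = "map Suc"])
    show "map Suc ` {\<tau> \<in> ?T'. avoids B (weave ?\<pi> ?g \<tau>)} \<subseteq> {\<tau> \<in> ?T. avoids B (weave \<pi> g \<tau>)}"
      using bij' avoid by fastforce
  qed (use bij bij' avoid in auto)
  then show ?thesis
    using card_Z[OF assms(1,2)] card_Z[OF d(2) len(1)] len(2) d(3) by (simp add: bij_betw_same_card)
qed

subsection \<open>Slots and regular insertion encodings\<close>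

fun slot_change :: "move \<Rightarrow> int" where
  "slot_change (M j) = 1"
| "slot_change (L j) = 0"
| "slot_change (R j) = 0"
| "slot_change (F j) = -1"

lemma insertion_steps_slots:
  "insertion_steps x c w c' \<Longrightarrow>
    int (count_list c' None) = int (count_list c None) + sum_list (map slot_change w)"
proof (induction rule: insertion_steps.induct)
  case (Cons x c a c' w c'')
  from Cons.hyps(1) have "int (count_list c' None) = int (count_list c None) + slot_change a"
    by cases auto
  then show ?case using Cons.IH by simp
qed simp

lemma insertion_steps_append:
  "insertion_steps x c w c' \<Longrightarrow> insertion_steps (x + length w) c' w' c'' \<Longrightarrow>
    insertion_steps x c (w @ w') c''"
  by (induction rule: insertion_steps.induct) (auto intro: insertion_steps.intros)

lemma foldl_closed:
  "\<forall>q\<in>Q. \<forall>a\<in>\<Sigma>. \<delta> q a \<in> Q \<Longrightarrow> q \<in> Q \<Longrightarrow> set w \<subseteq> \<Sigma> \<Longrightarrow> foldl \<delta> q w \<in> Q"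
  by (induction w arbitrary: q) auto

text \<open>Completing a prefix to an accepted word closes all its slots, so the number of slots that a
  prefix leaves open is a function of the state that it reaches.\<close>

lemma regular_imp_slots_bounded:
  assumes "has_regular_insertion_encoding C"
  obtains K where "\<And>\<sigma> w w'. \<sigma> \<in> C \<Longrightarrow> \<sigma> \<noteq> [] \<Longrightarrow> insertion_encodes (w @ w') \<sigma> \<Longrightarrow>
    1 + sum_list (map slot_change w) \<le> int K"
proof -
  let ?L = "{w. \<exists>\<sigma>\<in>C. \<sigma> \<noteq> [] \<and> insertion_encodes w \<sigma>}"
  let ?bal = "\<lambda>w. sum_list (map slot_change w)"
  obtain \<Sigma> Q q0 \<delta> F where fin: "finite \<Sigma>" "finite (Q :: nat set)" and q0: "q0 \<in> Q"
    and closed: "\<forall>q\<in>Q. \<forall>a\<in>\<Sigma>. \<delta> q a \<in> Q" and L: "?L = {w \<in> lists \<Sigma>. foldl \<delta> q0 w \<in> F}"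
    using assms unfolding has_regular_insertion_encoding_def regular_language_def by blast
  have bal: "1 + ?bal w = 0" if "w \<in> ?L" for w
  proof -
    from that obtain \<sigma> where "insertion_steps 1 [None] w (map Some \<sigma>)"
      by (auto simp: insertion_encodes_def)
    moreover have "count_list (map Some \<sigma>) None = 0" by (auto simp: count_list_0_iff)
    ultimately show ?thesis using insertion_steps_slots by fastforce
  qed
  \<comment> \<open>\<open>V q\<close> is read off from some accepted word passing through
    \<open>q\<close>. Its value is arbitrary at other states, which can only raise the maximum taken
    below.\<close>
  define V where "V q = (SOME v. \<exists>u u'. u @ u' \<in> ?L \<and> foldl \<delta> q0 u = q \<and> v = 1 + ?bal u)" for q
  have V: "1 + ?bal w = V (foldl \<delta> q0 w)" if w: "w @ w' \<in> ?L" for w w'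
  proof -
    have "\<exists>u u'. u @ u' \<in> ?L \<and> foldl \<delta> q0 u = foldl \<delta> q0 w \<and> V (foldl \<delta> q0 w) = 1 + ?bal u"
      unfolding V_def by (rule someI_ex) (use w in blast)
    then obtain u u' where u: "u @ u' \<in> ?L" "foldl \<delta> q0 u = foldl \<delta> q0 w" "V (foldl \<delta> q0 w) = 1 + ?bal u"
      by blast
    \<comment> \<open>The suffixes may be exchanged because both prefixes reach the same state;
      closing with the same \<open>u'\<close> forces equal balances.\<close>
    have "w @ u' \<in> ?L" using u(1,2) w unfolding L by simp
    then have "1 + ?bal (w @ u') = 0" "1 + ?bal (u @ u') = 0" using bal u(1) by blast+
    then show ?thesis using u(3) by simp
  qed
  show ?thesis
  proof (rule that[of "nat (Max (V ` Q))"])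
    fix \<sigma> w w' assume "\<sigma> \<in> C" "\<sigma> \<noteq> []" "insertion_encodes (w @ w') \<sigma>"
    then have w: "w @ w' \<in> ?L" by blast
    then have "set w \<subseteq> \<Sigma>" unfolding L by auto
    then have "foldl \<delta> q0 w \<in> Q" by (rule foldl_closed[OF closed q0])
    then have "V (foldl \<delta> q0 w) \<le> Max (V ` Q)" using fin(2) by simp
    then show "1 + ?bal w \<le> int (nat (Max (V ` Q)))" using V[OF w] by linarith
  qed
qed

section \<open>Encoding a given permutation step by step\<close>

text \<open>The configuration \<open>c\<close> arises from \<open>\<sigma>\<close> by turning the nonempty words \<open>ws\<close> of entries
  greater than \<open>l\<close> into slots.\<close>

definition partial_fill :: "nat list \<Rightarrow> nat \<Rightarrow> config \<Rightarrow> nat list list \<Rightarrow> bool" where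
  "partial_fill \<sigma> l c ws \<longleftrightarrow> expand c ws = \<sigma> \<and> length ws = count_list c None \<and> lows c \<subseteq> {..l} \<and>
    (\<forall>w\<in>set ws. w \<noteq> [] \<and> set w \<subseteq> {l<..})"

lemma expand_append:
  "length ws = count_list c None \<Longrightarrow> expand (c @ d) (ws @ vs) = expand c ws @ expand d vs"
  by (induction c ws rule: expand.induct) auto

lemma expand_splitD:
  "length (us @ w # vs) = count_list c None \<Longrightarrow> \<exists>c1 c2. c = c1 @ None # c2 \<and>
    length us = count_list c1 None \<and> length vs = count_list c2 None"
proof (induction c arbitrary: us)
  case (Cons a c)
  show ?case
  proof (cases "a = None \<and> us = []")
    case True
    then show ?thesis using Cons.prems by (intro exI[of _ "[]"] exI[of _ c]) auto
  next
    case False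
    have "\<exists>us'. length (us' @ w # vs) = count_list c None \<and> length us = length us' + (if a = None then 1 else 0)"
      using False Cons.prems by (intro exI[of _ "if a = None then tl us else us"]) (cases us; auto)
    then obtain us' where "length (us' @ w # vs) = count_list c None" "length us = length us' + (if a = None then 1 else 0)"
      by blast
    then obtain c1 c2 where "c = c1 @ None # c2" "length us' = count_list c1 None" "length vs = count_list c2 None"
      using Cons.IH by blast
    then show ?thesis using \<open>length us = _\<close> by (intro exI[of _ "a # c1"] exI[of _ c2]) auto
  qed
qed simp

text \<open>The next entry splits exactly one word into \<open>a\<close> and \<open>b\<close>. The
  move is middle, left, right or fill according to which of these two are nonempty.\<close>

lemma partial_fill_step:
  assumes "partial_fill \<sigma> l c ws" "distinct \<sigma>" "Suc l \<in> set \<sigma>"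
  obtains a c' ws' where "insertion_step (Suc l) c a c'" "partial_fill \<sigma> (Suc l) c' ws'"
proof -
  have ws: "expand c ws = \<sigma>" "length ws = count_list c None" "lows c \<subseteq> {..l}"
    "\<And>w. w \<in> set ws \<Longrightarrow> w \<noteq> [] \<and> set w \<subseteq> {l<..}"
    using assms(1) by (auto simp: partial_fill_def)
  have "Suc l \<in> lows c \<union> set (concat ws)" using set_expand[OF ws(2)] ws(1) assms(3) by simp
  moreover have "Suc l \<notin> lows c" using ws(3) by auto
  ultimately obtain w where w: "w \<in> set ws" "Suc l \<in> set w" by auto
  from w(1) obtain us vs where uv: "ws = us @ w # vs" by (meson split_list)
  from w(2) obtain a b where ab: "w = a @ Suc l # b" by (meson split_list)
  from expand_splitD[of us w vs c] ws(2) uv obtain c1 c2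
    where c: "c = c1 @ None # c2" "length us = count_list c1 None" "length vs = count_list c2 None" by auto
  \<comment> \<open>The counterpart of \<open>slots\<close> for words: an empty piece leaves no slot
    behind, as every open slot must still receive an entry.\<close>
  define chunk where "chunk v = (if v = [] then [] else [v :: nat list])" for v
  have chunk: "length (chunk v) = count_list (slots (length v)) None"
    "expand (slots (length v) @ d) (chunk v @ xs) = v @ expand d xs" for v d xs
    by (auto simp: chunk_def slots_def)
  let ?c' = "c1 @ slots (length a) @ Some (Suc l) # slots (length b) @ c2"
    and ?ws' = "us @ chunk a @ chunk b @ vs"
  have \<sigma>: "\<sigma> = expand c1 us @ a @ Suc l # b @ expand c2 vs"
    using ws(1) unfolding uv c(1) ab by (simp add: expand_append c(2))
  have "expand ?c' ?ws' = \<sigma>"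
    by (simp add: expand_append c(2) chunk \<sigma>)
  moreover have "length ?ws' = count_list ?c' None" by (simp add: chunk c)
  moreover have "lows ?c' \<subseteq> {..Suc l}" using ws(3) c(1) by auto
  moreover have "v \<noteq> [] \<and> set v \<subseteq> {Suc l<..}" if v: "v \<in> set ?ws'" for v
  proof -
    have 1: "v \<noteq> [] \<and> set v \<subseteq> {l<..}"
      using v ws(4)[of v] ws(4)[OF w(1)] unfolding uv ab chunk_def by (auto split: if_splits)
    \<comment> \<open>Every word is a part of \<open>\<sigma>\<close>, so distinctness excludes a
      second \<open>Suc l\<close> from all of them.\<close>
    have "set us' \<subseteq> set (expand d vs')" if "us' \<in> set vs'" "length vs' = count_list d None" for us' vs' d
      using set_expand[OF that(2)] that(1) by auto
    then have "Suc l \<notin> set v" using v assms(2) c(2,3) unfolding \<sigma> chunk_def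
      by (fastforce split: if_splits)
    with 1 show ?thesis by (metis Suc_lessI greaterThan_iff subset_iff)
  qed
  ultimately have "partial_fill \<sigma> (Suc l) ?c' ?ws'" unfolding partial_fill_def by blast
  moreover have "\<exists>m. insertion_step (Suc l) c m ?c'"
    using insertion_step.middle[OF refl, of "Suc l" c1 c2] insertion_step.left[OF refl, of "Suc l" c1 c2]
      insertion_step.right[OF refl, of "Suc l" c1 c2] insertion_step.fill[OF refl, of "Suc l" c1 c2]
    unfolding c(1) by (cases "a = []"; cases "b = []") (auto simp: slots_def)
  ultimately show ?thesis using that by blast
qed

lemma partial_fill_steps:
  assumes "partial_fill \<sigma> l c ws" "is_perm \<sigma>" "l + d \<le> length \<sigma>"
  shows "\<exists>w c' ws'. insertion_steps (Suc l) c w c' \<and> length w = d \<and> partial_fill \<sigma> (l + d) c' ws'"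
  using assms
proof (induction d arbitrary: l c ws)
  case 0
  then show ?case using insertion_steps.Nil by fastforce
next
  case (Suc d)
  have "distinct \<sigma>" "Suc l \<in> set \<sigma>" using Suc.prems(2,3) by (auto simp: is_perm_def permutations_of_set_def)
  with Suc.prems(1) obtain a c1 ws1 where step: "insertion_step (Suc l) c a c1" "partial_fill \<sigma> (Suc l) c1 ws1"
    by (rule partial_fill_step)
  with Suc.IH[OF step(2) Suc.prems(2)] Suc.prems(3) obtain w c' ws'
    where "insertion_steps (Suc (Suc l)) c1 w c'" "length w = d" "partial_fill \<sigma> (Suc l + d) c' ws'" by auto
  then show ?case using insertion_steps.Cons[of "Suc l" c a c1 w c'] step(1)
    by (intro exI[of _ "a # w"] exI[of _ c'] exI[of _ ws']) auto
qed

lemma expand_no_slots: "count_list c None = 0 \<Longrightarrow> map Some (expand c []) = c"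
proof (induction c)
  case (Cons a c)
  then show ?case by (cases a) auto
qed simp

text \<open>An open slot would hold a nonempty word of values above \<open>length \<sigma>\<close>,
  which a permutation does not have.\<close>

lemma partial_fill_complete:
  assumes "partial_fill \<sigma> (length \<sigma>) c ws" "is_perm \<sigma>"
  shows "c = map Some \<sigma>"
proof -
  have "w \<notin> set ws" for w
  proof
    assume w: "w \<in> set ws"
    have "set (concat ws) \<subseteq> set \<sigma>" using assms(1) set_expand[of ws c] by (auto simp: partial_fill_def)
    then have "set w \<subseteq> {1..length \<sigma>}"
      using w assms(2) by (auto simp: is_perm_def permutations_of_set_def)
    moreover have "w \<noteq> []" "set w \<subseteq> {length \<sigma><..}" using w assms(1) by (auto simp: partial_fill_def)
    ultimately show False by (cases w) auto
  qed
  then have "ws = []" by (cases ws) auto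
  then show ?thesis using assms(1) expand_no_slots[of c] by (auto simp: partial_fill_def)
qed

section \<open>From slots to nonzero gaps\<close>

lemma gaps_append_high:
  "\<forall>x\<in>set v. \<not> P x \<Longrightarrow> gaps P (v @ \<sigma>) = (length v + hd (gaps P \<sigma>)) # tl (gaps P \<sigma>)"
  by (induction v) auto

text \<open>Each word of high entries lengthens a single gap. Adjacent slots may share a gap and an
  empty word adds nothing, hence only an inequality.\<close>

lemma gaps_expand_le:
  assumes "length ws = count_list c None" "\<forall>w\<in>set ws. \<forall>x\<in>set w. \<not> P x" "\<forall>x\<in>lows c. P x"
  shows "length (filter (\<lambda>a. a \<noteq> 0) (gaps P (expand c ws))) \<le> count_list c None"
  using assms
proof (induction c ws rule: expand.induct)
  case (4 c w ws)
  then have "length (filter (\<lambda>a. a \<noteq> 0) (gaps P (expand c ws))) \<le> count_list c None" by simp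
  then show ?case using 4(3) by (cases "gaps P (expand c ws)") (auto simp: gaps_append_high split: if_splits)
qed auto

lemma regular_imp_gaps_bounded:
  assumes "has_regular_insertion_encoding (Av B)"
  obtains K where "\<And>\<sigma> l. \<sigma> \<in> Av B \<Longrightarrow> l \<le> length \<sigma> \<Longrightarrow>
    length (filter (\<lambda>a. a \<noteq> 0) (gap_vector l \<sigma>)) \<le> K"
proof -
  from regular_imp_slots_bounded[OF assms] obtain K where K: "\<And>\<sigma> w w'. \<sigma> \<in> Av B \<Longrightarrow> \<sigma> \<noteq> [] \<Longrightarrow>
    insertion_encodes (w @ w') \<sigma> \<Longrightarrow> 1 + sum_list (map slot_change w) \<le> int K" by metis
  show ?thesis
  proof (rule that[of K])
    fix \<sigma> l assume \<sigma>: "\<sigma> \<in> Av B" and l: "l \<le> length \<sigma>"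
    show "length (filter (\<lambda>a. a \<noteq> 0) (gap_vector l \<sigma>)) \<le> K"
    proof (cases "\<sigma> = []")
      case True
      then show ?thesis by (simp add: gap_vector_eq_gaps)
    next
      case False
      have perm: "is_perm \<sigma>" using \<sigma> by (simp add: Av_def)
      then have "partial_fill \<sigma> 0 [None] [\<sigma>]"
        using False by (auto simp: partial_fill_def is_perm_def permutations_of_set_def)
      from partial_fill_steps[OF this perm, of l] l obtain w c ws
        where w: "insertion_steps 1 [None] w c" "length w = l" "partial_fill \<sigma> l c ws" by auto
      \<comment> \<open>Running on to the end shows that \<open>w\<close> is a prefix of a full
        encoding of \<open>\<sigma>\<close>, as the slot bound requires.\<close>
      from partial_fill_steps[OF w(3) perm, of "length \<sigma> - l"] l obtain w' c' ws'
        where w': "insertion_steps (Suc l) c w' c'" "partial_fill \<sigma> (length \<sigma>) c' ws'" by auto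
      have "insertion_steps 1 [None] (w @ w') (map Some \<sigma>)"
        using insertion_steps_append[OF w(1)] w(2) w'(1) partial_fill_complete[OF w'(2) perm] by simp
      then have "1 + sum_list (map slot_change w) \<le> int K"
        using K[OF \<sigma> False] by (simp add: insertion_encodes_def)
      then have "count_list c None \<le> K" using insertion_steps_slots[OF w(1)] by simp
      moreover have "length (filter (\<lambda>a. a \<noteq> 0) (gap_vector l \<sigma>)) \<le> count_list c None"
      proof -
        have fill: "expand c ws = \<sigma>" "length ws = count_list c None" "lows c \<subseteq> {..l}"
          "\<forall>w\<in>set ws. set w \<subseteq> {l<..}" using w(3) by (simp_all add: partial_fill_def)
        have "\<not> x \<le> l" if "v \<in> set ws" "x \<in> set v" for v x
          using fill(4) that by (meson greaterThan_iff leD subsetD)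
        then have "length (filter (\<lambda>a. a \<noteq> 0) (gaps (\<lambda>x. x \<le> l) (expand c ws))) \<le> count_list c None"
          using fill(2,3) by (intro gaps_expand_le) auto
        then show ?thesis by (simp add: gap_vector_eq_gaps fill(1))
      qed
      ultimately show ?thesis by linarith
    qed
  qed
qed

subsection \<open>Replacement rules for long downfixes\<close>

text \<open>The sum is strictly monotone for the componentwise order; this identifies the first
  dominated vector in a list sorted by sum.\<close>

lemma sum_list_eqD:
  fixes h s :: "nat list"
  assumes "list_all2 (\<le>) h s" "sum_list s \<le> sum_list h"
  shows "h = s"
proof -
  have "sum_list h \<le> sum_list s \<and> (sum_list s \<le> sum_list h \<longrightarrow> h = s)"
    using assms(1) by (induction rule: list_all2_induct) auto
  with assms(2) show ?thesis by blast
qed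

text \<open>With \<open>dominates_own_support_vector\<close>, this makes the support vector the
  greatest 0-1 vector that \<open>g\<close> dominates.\<close>

lemma dominates_support_vector:
  assumes "dominates g h" "set h \<subseteq> {0, 1}"
  shows "list_all2 (\<le>) h (support_vector g)"
proof -
  have "length g = length h" "\<And>i. i < length h \<Longrightarrow> h ! i \<le> g ! i"
    using assms(1) by (auto simp: dominates_def list_all2_conv_all_nth)
  moreover have "h ! i \<le> 1" if "i < length h" for i using nth_mem[OF that] assms(2) by auto
  ultimately show ?thesis by (fastforce simp: list_all2_conv_all_nth support_vector_def)
qed

lemma dominates_own_support_vector: "dominates g (support_vector g)"
  by (auto simp: dominates_def list_all2_conv_all_nth support_vector_def)

text \<open>The redundant entry is chosen from the skeleton of \<open>s\<close>, before any
  \<open>g\<close> is given. All \<open>g\<close> of the same support share this skeleton, so one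
  \<open>r\<close> serves them all.\<close>

lemma ex_uniform_deletion:
  assumes \<pi>: "is_perm \<pi>" and B: "\<forall>p\<in>B. length p \<le> m" and N: "card (shapes m K) * m < length \<pi>"
    and s: "length s = length \<pi> + 1" "length (filter (\<lambda>a. a \<noteq> 0) s) \<le> K"
  shows "\<exists>r. 0 < r \<and> r \<le> length \<pi> \<and> (\<forall>g. length g = length \<pi> + 1 \<and> support_vector g = support_vector s \<longrightarrow>
    card (Z B \<pi> g) = card (Z B (delete_perm r \<pi>) (delete_gap r g)))"
proof -
  let ?c = "skeleton \<pi> s"
  have c: "count_list ?c None \<le> K" using s by (simp add: count_list_skeleton)
  have "card (set \<pi>) = length \<pi>" using \<pi> distinct_card by (auto simp: is_perm_iff)
  with N have "card (shapes m K) * m < card (set \<pi>)" by simp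
  from ex_redundant_entry[OF c this] obtain x where x: "x \<in> set \<pi>"
    and redundant: "\<And>d. subseq d ?c \<Longrightarrow> count_list d None = count_list ?c None \<Longrightarrow> length d \<le> m + count_list ?c None \<Longrightarrow>
      \<exists>d'. subseq d' ?c \<and> count_list d' None = count_list ?c None \<and> shape d' = shape d \<and> x \<notin> lows d'"
    by auto
  from x obtain i where i: "i < length \<pi>" "\<pi> ! i = x" by (auto simp: in_set_conv_nth)
  have low: "set \<pi> = {1..length \<pi>}" using \<pi> by (simp add: is_perm_iff)
  have "card (Z B \<pi> g) = card (Z B (delete_perm (Suc i) \<pi>) (delete_gap (Suc i) g))"
    if g: "length g = length \<pi> + 1" "support_vector g = support_vector s" for g
  proof (rule card_Z_delete[OF \<pi> g(1)])
    fix \<tau> assume "\<tau> \<in> permutations_of_set {length \<pi> <.. length \<pi> + sum_list g}"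
    then have \<tau>: "set \<tau> = {length \<pi> <.. length \<pi> + sum_list g}" "sum_list g = length \<tau>"
      using distinct_card[of \<tau>] by (auto simp: permutations_of_set_def)
    have sk: "skeleton \<pi> g = ?c"
      using skeleton_support_vector[OF g(1)] skeleton_support_vector[OF s(1)] g(2) by metis
    from weave_eq_expand_skeleton[OF g(1) \<tau>(2)] obtain ws where
      ws: "length ws = count_list ?c None" "concat ws = \<tau>" "weave \<pi> g \<tau> = expand ?c ws"
      unfolding sk by blast
    show "avoids B (filter (\<lambda>y. y \<noteq> \<pi> ! (Suc i - 1)) (weave \<pi> g \<tau>)) \<longleftrightarrow> avoids B (weave \<pi> g \<tau>)"
      unfolding ws(3) diff_Suc_1 i(2)
      by (rule avoids_filter_redundant[OF redundant B, where l = "length \<pi>"])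
        (use ws low \<tau>(1) x in \<open>auto simp: lows_skeleton\<close>)
  qed (use i in auto)
  then show ?thesis using i(1) by (intro exI[of _ "Suc i"]) auto
qed

text \<open>The 0-1 vectors are listed by decreasing sum, so that the first one dominated by \<open>g\<close> is the
  indicator vector of the support of \<open>g\<close>.\<close>

lemma ex_reduction:
  assumes \<pi>: "is_perm \<pi>" and B: "\<forall>p\<in>B. length p \<le> m" and N: "card (shapes m K) * m < length \<pi>"
    and K: "\<And>\<sigma> l. \<sigma> \<in> Av B \<Longrightarrow> l \<le> length \<sigma> \<Longrightarrow> length (filter (\<lambda>a. a \<noteq> 0) (gap_vector l \<sigma>)) \<le> K"
  shows "\<exists>H. H \<noteq> [] \<and> replacement_rule B (\<pi>, H)"
proof -
  let ?n = "length \<pi> + 1" and ?nz = "\<lambda>g. length (filter (\<lambda>a. a \<noteq> (0 :: nat)) g)"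
  let ?good = "\<lambda>s r. 0 < r \<and> r \<le> length \<pi> \<and> (\<forall>g. length g = ?n \<and> support_vector g = support_vector s \<longrightarrow>
    card (Z B \<pi> g) = card (Z B (delete_perm r \<pi>) (delete_gap r g)))"
  \<comment> \<open>The value 0 declares \<open>Z\<close> empty, which is correct for supports of
    more than \<open>K\<close> positions.\<close>
  define R where "R s = (if ?nz s \<le> K \<and> length s = ?n then SOME r. ?good s r else 0)" for s
  have R: "?good s (R s)" if "length s = ?n" "?nz s \<le> K" for s
  proof -
    have "R s = (SOME r. ?good s r)" unfolding R_def by (rule if_P) (use that in blast)
    then show ?thesis by (rule ssubst) (rule someI_ex[OF ex_uniform_deletion[OF \<pi> B N that]])
  qed
  have R_le: "R s \<le> length \<pi>" for s
  proof (cases "?nz s \<le> K \<and> length s = ?n")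
    case True
    then show ?thesis using R by blast
  next
    case False
    then have "R s = 0" unfolding R_def by (rule if_not_P)
    then show ?thesis by simp
  qed
  define hs where "hs = rev (sort_key sum_list (List.n_lists ?n [0, 1 :: nat]))"
  \<comment> \<open>The appended zero vector gives the list its required last entry; the first
    dominated vector is always found within \<open>hs\<close>.\<close>
  define H where "H = map (\<lambda>h. (h, R h)) (hs @ [replicate ?n 0])"
  have hs: "set hs = {h. length h = ?n \<and> set h \<subseteq> {0, 1}}"
    unfolding hs_def by (simp only: set_rev set_sort set_n_lists list.set)
  have sorted: "sorted_wrt (\<lambda>h h'. sum_list h' \<le> sum_list h) hs"
    unfolding hs_def sorted_wrt_rev using sorted_sort_key by (simp only: sorted_map)
  have first: "H ! i = (support_vector g, R (support_vector g))"
    if g: "length g = ?n" and i: "first_dominated g H i" for g i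
  proof -
    have "support_vector g \<in> set hs" unfolding hs using g by (auto simp: support_vector_def)
    then obtain j where j: "j < length hs" "hs ! j = support_vector g" by (auto simp: in_set_conv_nth)
    then have "dominates g (fst (H ! j))" by (simp add: H_def nth_append dominates_own_support_vector)
    then have "i \<le> j" using i unfolding first_dominated_def by (meson not_le)
    then have Hi: "H ! i = (hs ! i, R (hs ! i))" using j(1) by (simp add: H_def nth_append)
    have "hs ! i \<in> set hs" using \<open>i \<le> j\<close> j(1) by simp
    then have "set (hs ! i) \<subseteq> {0, 1}" unfolding hs by simp
    moreover have "dominates g (hs ! i)" using i Hi by (simp add: first_dominated_def)
    ultimately have "list_all2 (\<le>) (hs ! i) (support_vector g)" by (rule dominates_support_vector[rotated])
    moreover have "sum_list (support_vector g) \<le> sum_list (hs ! i)"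
      using sorted_wrt_nth_less[OF sorted, of i j] \<open>i \<le> j\<close> j by (cases "i = j") auto
    ultimately have "hs ! i = support_vector g" by (rule sum_list_eqD)
    with Hi show ?thesis by simp
  qed
  have idem: "support_vector (support_vector g) = support_vector g" "length (support_vector g) = length g"
    "?nz (support_vector g) = ?nz g" for g
    by (induction g) (auto simp: support_vector_def)
  have empty: "Z B \<pi> g = {}" if "\<not> ?nz g \<le> K" for g
    using K[of _ "length \<pi>"] that by (force simp: Z_def)
  have "replacement_rule B (\<pi>, H)"
    unfolding replacement_rule_def
  proof (simp only: prod.case, intro conjI disjI2 allI impI)
    show "is_perm \<pi>" by (rule \<pi>)
    show "\<forall>(h, r) \<in> set H. length h = ?n \<and> r \<le> length \<pi>"
      using hs R_le by (auto simp: H_def)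
    show "fst (last H) = replicate ?n 0" by (simp add: H_def)
    fix g i assume "length g = ?n \<and> first_dominated g H i"
    then have g: "length g = ?n" and r: "snd (H ! i) = R (support_vector g)" using first by auto
    show "let r = snd (H ! i) in (r = 0 \<longrightarrow> card (Z B \<pi> g) = 0) \<and>
      (r \<noteq> 0 \<longrightarrow> card (Z B \<pi> g) = card (Z B (delete_perm r \<pi>) (delete_gap r g)))"
    proof (cases "?nz g \<le> K")
      case True
      have len: "length (support_vector g) = ?n" and nz: "?nz (support_vector g) \<le> K"
        unfolding idem by (rule g, rule True)
      note good = R[OF len nz]
      have "card (Z B \<pi> g) = card (Z B (delete_perm (R (support_vector g)) \<pi>) (delete_gap (R (support_vector g)) g))"
        by (rule good[THEN conjunct2, THEN conjunct2, rule_format]) (rule conjI[OF g idem(1)[symmetric]])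
      then show ?thesis unfolding r Let_def using good[THEN conjunct1] by (intro conjI impI) simp_all
    next
      case False
      then have "\<not> (?nz (support_vector g) \<le> K \<and> length (support_vector g) = ?n)" unfolding idem(3) by blast
      then have "R (support_vector g) = 0" unfolding R_def by (rule if_not_P)
      then show ?thesis using empty[OF False] by (simp add: r)
    qed
  qed
  moreover have "H \<noteq> []" by (simp add: H_def)
  ultimately show ?thesis by blast
qed

section \<open>Assembling the finite scheme\<close>

lemma finite_perms_length: "finite {\<pi>. is_perm \<pi> \<and> length \<pi> \<le> n}"
proof (rule finite_subset)
  show "{\<pi>. is_perm \<pi> \<and> length \<pi> \<le> n} \<subseteq> {\<pi>. set \<pi> \<subseteq> {1..n} \<and> length \<pi> \<le> n}"
    by (auto simp: is_perm_iff)
qed (simp add: finite_lists_length_le)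

lemma refinements_perm:
  assumes "is_perm \<pi>" "\<rho> \<in> refinements \<pi>"
  shows "is_perm \<rho>" "length \<rho> = Suc (length \<pi>)"
proof -
  obtain i where i: "\<rho> = take i \<pi> @ [length \<pi> + 1] @ drop i \<pi>" "i \<le> length \<pi>"
    using assms(2) by (auto simp: refinements_def)
  have "mset (take i \<pi>) + mset (drop i \<pi>) = mset \<pi>" by (metis append_take_drop_id mset_append)
  then have mset: "mset \<rho> = mset (Suc (length \<pi>) # \<pi>)" unfolding i(1) by simp
  show len: "length \<rho> = Suc (length \<pi>)" using mset_eq_length[OF mset] by simp
  have "set \<rho> = insert (Suc (length \<pi>)) (set \<pi>)" using mset_eq_setD[OF mset] by simp
  then have "set \<rho> = {1..length \<rho>}" using assms(1) by (auto simp: is_perm_iff len)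
  moreover have "distinct \<rho>" using mset_eq_imp_distinct_iff[OF mset] assms(1) by (simp add: is_perm_iff)
  ultimately show "is_perm \<rho>" by (simp add: is_perm_iff)
qed

theorem theorem3p1:
  fixes B :: "nat list set"
  assumes "finite B"
    and "\<forall>p\<in>B. is_perm p"
    and "has_regular_insertion_encoding (Av B)"
  shows "has_finite_flexible_scheme B"
proof -
  obtain K where K: "\<And>\<sigma> l. \<sigma> \<in> Av B \<Longrightarrow> l \<le> length \<sigma> \<Longrightarrow>
    length (filter (\<lambda>a. a \<noteq> 0) (gap_vector l \<sigma>)) \<le> K"
    using regular_imp_gaps_bounded[OF assms(3)] by blast
  have "finite (length ` B)" using assms(1) by simp
  then obtain m where m: "\<forall>p\<in>B. length p \<le> m" by (auto simp: finite_nat_set_iff_bounded_le)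
  \<comment> \<open>The successor provides the strict inequality of the pigeonhole argument at
    length exactly \<open>N\<close>.\<close>
  define N where "N = Suc (card (shapes m K) * m)"
  \<comment> \<open>Only downfixes of length \<open>N\<close> are reduced; all shorter ones are
    refined.\<close>
  define H where "H \<pi> = (if length \<pi> = N then SOME H. H \<noteq> [] \<and> replacement_rule B (\<pi>, H) else [])" for \<pi>
  have H: "H \<pi> \<noteq> []" "replacement_rule B (\<pi>, H \<pi>)" if "is_perm \<pi>" "length \<pi> = N" for \<pi>
    using someI_ex[OF ex_reduction[OF that(1) m _ K]] that by (auto simp: H_def N_def)
  let ?P = "{\<pi>. is_perm \<pi> \<and> length \<pi> \<le> N}"
  define S where "S = (\<lambda>\<pi>. (\<pi>, H \<pi>)) ` ?P"
  have S: "(\<pi>, G) \<in> S \<longleftrightarrow> is_perm \<pi> \<and> length \<pi> \<le> N \<and> G = H \<pi>" for \<pi> G by (auto simp: S_def)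
  have dom: "fst ` S = ?P" by (simp add: S_def image_image)
  have rule: "replacement_rule B (\<pi>, H \<pi>)" if "\<pi> \<in> ?P" for \<pi>
    using that H(2)[of \<pi>] by (cases "length \<pi> = N") (simp_all add: H_def replacement_rule_def)
  have "flexible_scheme B S"
    unfolding flexible_scheme_def dom
  proof (intro conjI allI impI)
    show "\<forall>\<rho>\<in>S. replacement_rule B \<rho>" using rule by (auto simp: S_def)
    show "[] \<in> ?P" by (simp add: is_perm_iff)
  next
    fix \<pi> assume "(\<pi>, []) \<in> S"
    \<comment> \<open>An empty list occurs only below length \<open>N\<close>, so refining never
      goes beyond \<open>N\<close>.\<close>
    then have \<pi>: "is_perm \<pi>" "length \<pi> \<le> N" "length \<pi> \<noteq> N" using H(1)[of \<pi>] by (auto simp: S)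
    then show "refinements \<pi> \<subseteq> ?P" using refinements_perm[OF \<pi>(1)] by auto
  next
    fix \<pi> G h r assume asm: "(\<pi>, G) \<in> S \<and> (h, r) \<in> set G \<and> r \<noteq> 0"
    then have \<pi>: "is_perm \<pi>" "length \<pi> \<le> N" and G: "G = H \<pi>" by (auto simp: S)
    then have "replacement_rule B (\<pi>, G)" using rule by simp
    then have "r \<le> length \<pi>" using asm by (auto simp: replacement_rule_def)
    then show "delete_perm r \<pi> \<in> ?P" using delete_perm_eq(2,3)[OF \<pi>(1)] asm \<pi>(2) by auto
  qed (auto simp: S)
  moreover have "finite S" unfolding S_def using finite_perms_length by blast
  ultimately show ?thesis unfolding has_finite_flexible_scheme_def by blast
qed

end
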